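(* Let $f(z)=z+\sum_{n\ge 2}a_nz^n$ belong to $\mathcal{S}^*_B$, and let $\mathcal{T}_{2,2}(f)=a_2^2-a_3^2$. Then $$|\mathcal{T}_{2,2}(f)|\le \frac{25}{16}.$$ This inequality is sharp, i.e. equality holds for some function in $\mathcal{S}^*_B$.
   Context: Let $\mathbb{D}=\{z\in\mathbb{C}:|z|<1\}$ and let $\mathcal{A}$ be the class of analytic functions $f$ on $\mathbb{D}$ with $f(0)=0$, $f'(0)=1$, written $f(z)=z+\sum_{n=2}^\infty a_nz^n$. For analytic functions $g,h$ on $\mathbb{D}$, $g\prec h$ ($g$ is subordinate to $h$) means $g(z)=h(w(z))$ on $\mathbb{D}$ for some analytic $w:\mathbb{D}\to\mathbb{D}$ with $w(0)=0$. Let $B(z)=\dfrac{1}{1-\log(1+z)}$ on $\mathbb{D}$ (principal branch of the logarithm), and let $$\mathcal{S}^*_B=\left\{f\in\mathcal{A}:\ \frac{zf'(z)}{f(z)}\prec B(z)\right\}.$$ *)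

theory Defs
  imports "HOL-Complex_Analysis.Complex_Analysis"
begin

abbreviation unit_disc :: "complex set" where
  "unit_disc \<equiv> ball 0 1"

text \<open>Functions on the disc are total functions of which only the values on the disc matter.\<close>

definition class_A :: "(complex \<Rightarrow> complex) set" where
  "class_A = {f. f holomorphic_on unit_disc \<and> f 0 = 0 \<and> deriv f 0 = 1}"

definition subordinate :: "(complex \<Rightarrow> complex) \<Rightarrow> (complex \<Rightarrow> complex) \<Rightarrow> bool"
    (infix "\<prec>\<^sub>s" 50) where
  "g \<prec>\<^sub>s h \<longleftrightarrow>
     g holomorphic_on unit_disc \<and> h holomorphic_on unit_disc \<and>
     (\<exists>w. w holomorphic_on unit_disc \<and> w ` unit_disc \<subseteq> unit_disc \<and> w 0 = 0 \<and>
          (\<forall>z\<in>unit_disc. g z = h (w z)))"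

definition B :: "complex \<Rightarrow> complex" where
  "B z = 1 / (1 - Ln (1 + z))"

text \<open>The function \<open>z f'(z) / f(z)\<close>. For \<open>f \<in> class_A\<close> its singularity at 0 is removable
  with value 1, which has to be supplied because \<open>0 / 0 = 0\<close> in HOL.\<close>

definition zlogderiv :: "(complex \<Rightarrow> complex) \<Rightarrow> complex \<Rightarrow> complex" where
  "zlogderiv f z = (if z = 0 then 1 else z * deriv f z / f z)"

text \<open>The nonvanishing condition says that the quotient is defined on the whole punctured disc;
  on paper it is part of the assertion that \<open>z f'(z) / f(z)\<close> is analytic on the disc.\<close>

definition S_B :: "(complex \<Rightarrow> complex) set" where
  "S_B = {f \<in> class_A. (\<forall>z\<in>unit_disc - {0}. f z \<noteq> 0) \<and> zlogderiv f \<prec>\<^sub>s B}"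

definition T22 :: "(complex \<Rightarrow> complex) \<Rightarrow> complex" where
  "T22 f = (fps_nth (fps_expansion f 0) 2)\<^sup>2 - (fps_nth (fps_expansion f 0) 3)\<^sup>2"

end

(* If z f'/f = B o w with w(z) = c1 z + c2 z^2 + ..., then a2 = c1 and a3 = c2/2 + (3/4) c1^2.
   The Schwarz-Pick bound |c2| <= 1 - |c1|^2 yields |a2| <= 1 and |a3| <= 3/4, and the triangle
   inequality gives |a2^2 - a3^2| <= 1 + 9/16. The choice w(z) = i z makes a2^2 = -1 and
   a3^2 = 9/16, so all inequalities become equalities. *)
theory Submission
  imports Defs
begin

section \<open>Coefficient bounds for Schwarz functions\<close>

lemma fps_expansion_unique_eventually:
  fixes F G :: "complex fps"
  assumes "f has_fps_expansion F" "g has_fps_expansion G" "eventually (\<lambda>z. f z = g z) (nhds 0)"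
  shows "F = G"
  using assms has_fps_expansion_cong[OF assms(3) refl] fps_expansion_unique_complex by blast

text \<open>Dividing out the zero, \<open>w z = z * h z\<close>, turns the first two coefficients of
  \<open>w\<close> into \<open>h 0\<close> and \<open>deriv h 0\<close>. The second bound is then
  the Schwarz-Pick inequality for \<open>h\<close> at the origin.\<close>

lemma Schwarz_second_coeff_bound:
  assumes holw: "w holomorphic_on unit_disc" and w0: "w 0 = 0"
    and wd: "w ` unit_disc \<subseteq> unit_disc"
  shows "cmod (fps_nth (fps_expansion w 0) 1) \<le> 1"
    and "cmod (fps_nth (fps_expansion w 0) 2) \<le> 1 - (cmod (fps_nth (fps_expansion w 0) 1))\<^sup>2"
proof -
  let ?W = "fps_expansion w 0"
  have no: "cmod (w z) < 1" if "cmod z < 1" for z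
    using subsetD[OF wd imageI, of z] that by simp
  obtain h where holh: "h holomorphic_on unit_disc"
    and wh: "\<And>z. cmod z < 1 \<Longrightarrow> w z = z * h z" and dw0: "deriv w 0 = h 0"
    using Schwarz3 [OF holw w0] by blast
  have "h has_fps_expansion fps_expansion h 0"
    using holh by (intro has_fps_expansion_fps_expansion[of unit_disc]) auto
  then have "(\<lambda>z. z * h z) has_fps_expansion fps_X * fps_expansion h 0"
    by (intro fps_expansion_intros)
  moreover have expw: "w has_fps_expansion ?W"
    using holw by (intro has_fps_expansion_fps_expansion[of unit_disc]) auto
  moreover have ev: "eventually (\<lambda>z. z \<in> unit_disc) (nhds (0::complex))"
    by (intro eventually_nhds_in_open) auto
  then have "eventually (\<lambda>z. w z = z * h z) (nhds 0)"
    by eventually_elim (simp add: wh)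
  ultimately have "?W = fps_X * fps_expansion h 0"
    using fps_expansion_unique_eventually by blast
  then have W1: "fps_nth ?W 1 = h 0" and W2: "fps_nth ?W 2 = deriv h 0"
    by (simp_all add: fps_expansion_def)
  have h0: "cmod (h 0) \<le> 1"
    using Schwarz_Lemma(2) [OF holw w0 no, of 0] dw0 by simp
  then show "cmod (fps_nth ?W 1) \<le> 1"
    using W1 by simp
  have "cmod (deriv h 0) \<le> 1 - (cmod (h 0))\<^sup>2"
  proof (cases "cmod (h 0) = 1")
    \<comment> \<open>Here the Moebius map used below degenerates. Equality in the Schwarz lemma
      makes \<open>w\<close> a rotation instead, so its second coefficient vanishes.\<close>
    case True
    then obtain \<alpha> where \<alpha>: "\<And>z. cmod z < 1 \<Longrightarrow> w z = \<alpha> * z"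
      using Schwarz_Lemma(3) [OF holw w0 no, of 0] dw0 by auto
    have "(\<lambda>z. \<alpha> * z) has_fps_expansion fps_const \<alpha> * fps_X"
      by (intro fps_expansion_intros)
    moreover have "eventually (\<lambda>z. w z = \<alpha> * z) (nhds 0)"
      using ev by eventually_elim (simp add: \<alpha>)
    ultimately have "?W = fps_const \<alpha> * fps_X"
      using expw fps_expansion_unique_eventually by blast
    then have "deriv h 0 = 0"
      using W2 by simp
    then show ?thesis
      using True by simp
  next
    case False
    define a where "a = h 0"
    have a: "cmod a < 1"
      using False h0 by (simp add: a_def)
    have hlt: "cmod (h z) < 1" if z: "cmod z < 1" for z
    proof (cases "z = 0")
      case True
      then show ?thesis using a by (simp add: a_def)
    next
      case z0: False
      \<comment> \<open>A rotation would have a derivative of modulus 1 at the origin, against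
        \<open>cmod (h 0) < 1\<close>. Hence equality in the Schwarz lemma is excluded and
        \<open>h\<close> maps into the open disc.\<close>
      have "\<not> (\<exists>\<alpha>. (\<forall>z. cmod z < 1 \<longrightarrow> w z = \<alpha> * z) \<and> cmod \<alpha> = 1)"
      proof
        assume "\<exists>\<alpha>. (\<forall>z. cmod z < 1 \<longrightarrow> w z = \<alpha> * z) \<and> cmod \<alpha> = 1"
        then obtain \<alpha> where "\<And>z. z \<in> unit_disc \<Longrightarrow> w z = \<alpha> * z" "cmod \<alpha> = 1"
          by auto
        moreover have "((\<lambda>z. \<alpha> * z) has_field_derivative \<alpha>) (at 0)"
          by (auto intro!: derivative_eq_intros)
        ultimately have "(w has_field_derivative \<alpha>) (at 0)"
          by - (rule has_field_derivative_transform_within_open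
              [where f = "\<lambda>z. \<alpha> * z" and S = unit_disc], auto)
        then show False
          using False dw0 \<open>cmod \<alpha> = 1\<close> by (auto dest: DERIV_imp_deriv)
      qed
      then have "cmod (w z) \<noteq> cmod z"
        using Schwarz_Lemma(3) [OF holw w0 no, of z] z z0 by blast
      moreover have "cmod (w z) \<le> cmod z"
        using Schwarz_Lemma(1) [OF holw w0 no z] .
      ultimately have "cmod z * cmod (h z) < cmod z * 1"
        using wh[OF z] by (simp add: norm_mult)
      then show ?thesis
        by (rule mult_left_less_imp_less) simp
    qed
    \<comment> \<open>This is the disc automorphism (z - a) / (1 - cnj a * z). It sends
      \<open>h 0\<close> to 0, so the Schwarz lemma bounds the derivative of
      \<open>?M \<circ> h\<close> at 0 by 1. Its own derivative at \<open>a\<close> is 1 / (1 -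
      |a|^2), and the chain rule yields the bound for \<open>deriv h 0\<close>.\<close>
    let ?M = "Moebius_function 0 a"
    have "(?M \<circ> h) holomorphic_on unit_disc"
      using hlt a by (intro holomorphic_on_compose_gen[OF holh Moebius_function_holomorphic]) auto
    moreover have "(?M \<circ> h) 0 = 0"
      by (simp add: a_def Moebius_function_eq_zero)
    ultimately have le: "cmod (deriv (?M \<circ> h) 0) \<le> 1"
      using Schwarz_Lemma(2)[of "?M \<circ> h" 0] hlt a Moebius_function_norm_lt_1 by auto
    have nz: "1 - cnj a * a = of_real (1 - (cmod a)\<^sup>2)"
      by (metis complex_norm_square mult.commute of_real_1 of_real_diff)
    have pos: "1 - (cmod a)\<^sup>2 > 0"
      using a by (simp add: power_less_one_iff abs_square_less_1)
    have "(?M has_field_derivative 1 / (1 - cnj a * a)) (at a)"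
      unfolding Moebius_function_simple
      using pos nz by (auto intro!: derivative_eq_intros simp del: of_real_diff simp: divide_simps)
    moreover have "(h has_field_derivative deriv h 0) (at 0)"
      using holh by (intro holomorphic_derivI) auto
    ultimately have "(?M \<circ> h has_field_derivative 1 / (1 - cnj a * a) * deriv h 0) (at 0)"
      by (intro DERIV_chain) (auto simp: a_def)
    then have "deriv (?M \<circ> h) 0 = deriv h 0 / of_real (1 - (cmod a)\<^sup>2)"
      using nz by (auto dest: DERIV_imp_deriv)
    then show ?thesis
      using le pos by (simp add: norm_divide a_def del: of_real_diff)
  qed
  then show "cmod (fps_nth ?W 2) \<le> 1 - (cmod (fps_nth ?W 1))\<^sup>2"
    using W1 W2 by simp
qed

section \<open>Analyticity of \<open>B\<close> on the disc\<close>

lemma Re_one_plus_pos: "cmod z < 1 \<Longrightarrow> Re (1 + z) > 0"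
  using abs_Re_le_cmod[of z] by simp

text \<open>Equality would force z = e - 1 > 1, outside the disc. Thus the denominator of
  \<open>B\<close> has no zero there.\<close>

lemma Ln_one_plus_neq_1:
  assumes "cmod z < 1"
  shows "Ln (1 + z) \<noteq> 1"
proof
  assume *: "Ln (1 + z) = 1"
  have "1 + z \<noteq> 0"
    using Re_one_plus_pos[OF assms] by (metis less_irrefl zero_complex.sel(1))
  then have "1 + z = exp 1"
    using * exp_Ln by metis
  then have "Re (1 + z) = Re (exp 1)"
    by simp
  then have "1 + Re z = exp 1"
    by (simp add: Re_exp)
  moreover have "Re z \<le> 1"
    using assms complex_Re_le_cmod[of z] by simp
  moreover have "exp 1 > (2::real)"
    using exp_lower_Taylor_quadratic[of "1::real"] by simp
  ultimately show False by simp
qed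

lemma one_plus_notin_nonpos_Reals: "cmod z < 1 \<Longrightarrow> 1 + z \<notin> \<real>\<^sub>\<le>\<^sub>0"
  using Re_one_plus_pos[of z] by (auto simp: complex_nonpos_Reals_iff)

lemma B_holomorphic: "B holomorphic_on unit_disc"
  unfolding B_def by (intro holomorphic_intros) (auto simp: one_plus_notin_nonpos_Reals Ln_one_plus_neq_1)

section \<open>Coefficients of \<open>f\<close> in terms of those of \<open>w\<close>\<close>

lemma starlike_B_coeffs:
  assumes f: "f \<in> class_A" and nz: "\<And>z. z \<in> unit_disc - {0} \<Longrightarrow> f z \<noteq> 0"
    and holw: "w holomorphic_on unit_disc" and w0: "w 0 = 0"
    and wd: "w ` unit_disc \<subseteq> unit_disc"
    and eq: "\<And>z. z \<in> unit_disc \<Longrightarrow> zlogderiv f z = B (w z)"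
  defines "c \<equiv> fps_nth (fps_expansion w 0)"
  shows "fps_nth (fps_expansion f 0) 2 = c 1"
    and "fps_nth (fps_expansion f 0) 3 = c 2 / 2 + 3 / 4 * (c 1)\<^sup>2"
proof -
  \<comment> \<open>The coefficients are read off from \<open>g' (1 + w) = w'\<close> and \<open>z f' (1 - g) = f\<close>.\<close>
  define g where "g z = Ln (1 + w z)" for z
  have w: "cmod (w z) < 1" if "z \<in> unit_disc" for z
    using subsetD[OF wd imageI, of z] that by simp
  have holf: "f holomorphic_on unit_disc" and f0: "f 0 = 0" and f1: "deriv f 0 = 1"
    using f by (auto simp: class_A_def)
  have holg: "g holomorphic_on unit_disc"
    unfolding g_def using w one_plus_notin_nonpos_Reals by (intro holomorphic_intros holw) auto
  define F where "F = fps_expansion f 0"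
  define G where "G = fps_expansion g 0"
  define W where "W = fps_expansion w 0"
  have exps: "f has_fps_expansion F" "g has_fps_expansion G" "w has_fps_expansion W"
    unfolding F_def G_def W_def using holf holg holw
    by (auto intro!: has_fps_expansion_fps_expansion[of unit_disc])
  have F0: "fps_nth F 0 = 0" "fps_nth F 1 = 1" and G0: "fps_nth G 0 = 0" and W0: "fps_nth W 0 = 0"
    by (simp_all add: F_def G_def W_def fps_expansion_def g_def f0 f1 w0)
  have ev: "eventually (\<lambda>z. z \<in> unit_disc) (nhds (0::complex))"
    by (intro eventually_nhds_in_open) auto
  have "(\<lambda>z. deriv g z * (1 + w z)) has_fps_expansion fps_deriv G * (1 + W)"
    by (intro fps_expansion_intros exps)
  moreover have "deriv w has_fps_expansion fps_deriv W"
    by (intro fps_expansion_intros exps)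
  moreover have "eventually (\<lambda>z. deriv g z * (1 + w z) = deriv w z) (nhds 0)"
    using ev
  proof eventually_elim
    case (elim z)
    have "(w has_field_derivative deriv w z) (at z)"
      using holw elim by (intro holomorphic_derivI) auto
    then have "(g has_field_derivative (deriv w z / (1 + w z))) (at z)"
      unfolding g_def using one_plus_notin_nonpos_Reals[OF w[OF elim]]
      by (auto intro!: derivative_eq_intros simp: divide_simps)
    then have "deriv g z = deriv w z / (1 + w z)"
      by (rule DERIV_imp_deriv)
    moreover have "1 + w z \<noteq> 0"
      using one_plus_notin_nonpos_Reals[OF w[OF elim]] by auto
    ultimately show ?case by simp
  qed
  ultimately have eqG: "fps_deriv G * (1 + W) = fps_deriv W"
    by (rule fps_expansion_unique_eventually)
  \<comment> \<open>With denominators cleared, the equation also holds at 0, where both sides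
    vanish, so the conventional value of \<open>zlogderiv f 0\<close> does not enter.\<close>
  have "(\<lambda>z. z * deriv f z * (1 - g z)) has_fps_expansion fps_X * fps_deriv F * (1 - G)"
    by (intro fps_expansion_intros exps)
  moreover have "eventually (\<lambda>z. z * deriv f z * (1 - g z) = f z) (nhds 0)"
    using ev
  proof eventually_elim
    case (elim z)
    show ?case
    proof (cases "z = 0")
      case False
      then have "z * deriv f z / f z = 1 / (1 - g z)"
        using eq[OF elim] by (simp add: zlogderiv_def B_def g_def)
      moreover have "f z \<noteq> 0" "1 - g z \<noteq> 0"
        using nz elim False Ln_one_plus_neq_1[OF w[OF elim]] by (auto simp: g_def)
      ultimately show ?thesis by (simp add: divide_simps)
    qed (simp add: f0)
  qed
  ultimately have eqF: "fps_X * fps_deriv F * (1 - G) = F"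
    using exps(1) by (blast intro: fps_expansion_unique_eventually)
  \<comment> \<open>The derivative shifts indices: coefficients 0 and 1 of \<open>eqG\<close>
    determine \<open>G\<close> up to order 2. In \<open>eqF\<close> the factor \<open>fps_X\<close>
    undoes the shift, so coefficients 2 and 3 determine those of \<open>F\<close>.\<close>
  have G1: "fps_nth G 1 = c 1"
    using arg_cong[OF eqG, of "\<lambda>H. fps_nth H 0"] W0 by (simp add: c_def W_def)
  have "2 * fps_nth G 2 + fps_nth G 1 * c 1 = 2 * c 2"
    using arg_cong[OF eqG, of "\<lambda>H. fps_nth H 1"] W0
    by (simp add: fps_mult_nth c_def W_def numeral_2_eq_2 add.commute)
  then have G2: "fps_nth G 2 = c 2 - (c 1)\<^sup>2 / 2"
    unfolding G1 by (simp add: field_simps power2_eq_square)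
  have "2 * fps_nth F 2 - fps_nth G 1 = fps_nth F 2"
    using arg_cong[OF eqF, of "\<lambda>H. fps_nth H 2"] F0 G0
    by (simp add: fps_mult_nth mult.assoc numeral_2_eq_2)
  then have F2: "fps_nth F 2 = c 1"
    unfolding G1 by (simp add: algebra_simps)
  have "3 * fps_nth F 3 - 2 * fps_nth F 2 * fps_nth G 1 - fps_nth G 2 = fps_nth F 3"
    using arg_cong[OF eqF, of "\<lambda>H. fps_nth H 3"] F0 G0
    by (simp add: fps_mult_nth mult.assoc numeral_2_eq_2 numeral_3_eq_3 algebra_simps)
  \<comment> \<open>The equation reads 2 a3 = 2 c1^2 + (c2 - c1^2 / 2), whence the factor
    3/4.\<close>
  then have "fps_nth F 3 = c 2 / 2 + 3 / 4 * (c 1)\<^sup>2"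
    unfolding G1 G2 F2 by (simp add: field_simps power2_eq_square)
  then show "fps_nth (fps_expansion f 0) 3 = c 2 / 2 + 3 / 4 * (c 1)\<^sup>2"
    "fps_nth (fps_expansion f 0) 2 = c 1"
    using F2 by (simp_all add: F_def)
qed

section \<open>The bound and its sharpness\<close>

lemma cmod_T22_le:
  assumes "f \<in> S_B"
  shows "cmod (T22 f) \<le> 25 / 16"
proof -
  obtain w where w: "w holomorphic_on unit_disc" "w 0 = 0" "w ` unit_disc \<subseteq> unit_disc"
    "\<And>z. z \<in> unit_disc \<Longrightarrow> zlogderiv f z = B (w z)"
    using assms by (auto simp: S_B_def subordinate_def)
  define c where "c = fps_nth (fps_expansion w 0)"
  have c: "cmod (c 1) \<le> 1" "cmod (c 2) \<le> 1 - (cmod (c 1))\<^sup>2"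
    using Schwarz_second_coeff_bound[OF w(1-3)] by (simp_all add: c_def)
  have sq: "(cmod (c 1))\<^sup>2 \<le> 1"
    using c(1) by (simp add: abs_square_le_1)
  have "cmod (c 2 / 2 + 3 / 4 * (c 1)\<^sup>2) \<le> cmod (c 2) / 2 + 3 / 4 * (cmod (c 1))\<^sup>2"
    by (rule order_trans[OF norm_triangle_ineq]) (simp add: norm_mult norm_power norm_divide)
  \<comment> \<open>With t = |c1|^2 and |c2| \<le> 1 - t the sum is at most 1/2 + t/4, and t \<le>
    1.\<close>
  also have "\<dots> \<le> 3 / 4"
    using c(2) sq by simp
  finally have "(cmod (c 2 / 2 + 3 / 4 * (c 1)\<^sup>2))\<^sup>2 \<le> (3 / 4)\<^sup>2"
    by (intro power_mono) auto
  moreover have "T22 f = (c 1)\<^sup>2 - (c 2 / 2 + 3 / 4 * (c 1)\<^sup>2)\<^sup>2"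
    using starlike_B_coeffs[of f w] w assms by (simp add: T22_def S_B_def c_def)
  then have "cmod (T22 f) \<le> (cmod (c 1))\<^sup>2 + (cmod (c 2 / 2 + 3 / 4 * (c 1)\<^sup>2))\<^sup>2"
    using norm_triangle_ineq4 by (metis norm_power)
  ultimately show ?thesis
    using sq by (simp add: power2_eq_square)
qed

text \<open>The function is recovered from its Schwarz function \<open>w\<close>: the equation z
  f'/f = B(w(z)) is solved by z times the exponential of a primitive of (B(w(z)) - 1) / z. The
  exponential makes \<open>f\<close> nonzero off the origin.\<close>

lemma T22_extremal: "\<exists>f\<in>S_B. cmod (T22 f) = 25 / 16"
proof -
  \<comment> \<open>The rotation by \<i> gives the two squares opposite signs, so that their moduli
    add up; the identity as \<open>w\<close> would only give 1 - 9/16 = 7/16.\<close>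
  define w where "w z = \<i> * z" for z :: complex
  have holw: "w holomorphic_on unit_disc"
    unfolding w_def by (intro holomorphic_intros)
  have w0: "w 0 = 0" and wd: "w ` unit_disc \<subseteq> unit_disc"
    by (auto simp: w_def norm_mult)
  have holBw: "(\<lambda>z. B (w z)) holomorphic_on unit_disc"
    using holomorphic_on_compose_gen[OF holw B_holomorphic wd] by (simp add: o_def)
  then have "(\<lambda>z. B (w z) - 1) holomorphic_on unit_disc"
    by (intro holomorphic_intros)
  moreover have "B (w 0) - 1 = 0"
    by (simp add: B_def w0)
  \<comment> \<open>\<open>Schwarz3\<close> serves here to remove the singularity of (B(w(z)) - 1) /
    z at 0.\<close>
  ultimately obtain h where holh: "h holomorphic_on unit_disc"
    and h: "\<And>z. cmod z < 1 \<Longrightarrow> B (w z) - 1 = z * h z"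
    using Schwarz3[of "\<lambda>z. B (w z) - 1" 1] by blast
  obtain g0 where g0: "\<And>z. z \<in> unit_disc \<Longrightarrow> (g0 has_field_derivative h z) (at z within unit_disc)"
    using holomorphic_convex_primitive'[OF convex_ball open_ball holh] by blast
  \<comment> \<open>Subtracting \<open>g0 0\<close> makes the exponential equal 1 at the origin,
    which gives \<open>deriv f 0 = 1\<close>.\<close>
  define f where "f z = z * exp (g0 z - g0 0)" for z
  have df: "(f has_field_derivative (1 + z * h z) * exp (g0 z - g0 0)) (at z)"
    if "z \<in> unit_disc" for z
  proof -
    have "(g0 has_field_derivative h z) (at z)"
      using g0[OF that] that by (simp add: at_within_open[of z unit_disc])
    then show ?thesis
      unfolding f_def by (auto intro!: derivative_eq_intros simp: algebra_simps)
  qed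
  then have holf: "f holomorphic_on unit_disc"
    by (subst holomorphic_on_open) blast+
  have A: "f \<in> class_A"
    using holf DERIV_imp_deriv[OF df[of 0]] by (simp add: class_A_def f_def)
  have nz: "f z \<noteq> 0" if "z \<in> unit_disc - {0}" for z
    using that by (simp add: f_def)
  have eq: "zlogderiv f z = B (w z)" if "z \<in> unit_disc" for z
  proof (cases "z = 0")
    case False
    then have "zlogderiv f z = 1 + z * h z"
      using DERIV_imp_deriv[OF df[OF that]] by (simp add: zlogderiv_def f_def)
    then show ?thesis
      using h[of z] that by (simp add: algebra_simps)
  qed (simp add: zlogderiv_def w0 B_def)
  \<comment> \<open>Subordination asks for holomorphy of \<open>zlogderiv f\<close>. It is inherited
    from B(w(z)), since the two agree on the whole disc, including the value 1 at 0.\<close>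
  then have "zlogderiv f holomorphic_on unit_disc \<longleftrightarrow> (\<lambda>z. B (w z)) holomorphic_on unit_disc"
    by (intro holomorphic_cong refl)
  then have "f \<in> S_B"
    unfolding S_B_def subordinate_def using holBw A nz eq holw w0 wd B_holomorphic by blast
  moreover have "fps_expansion w 0 = fps_const \<i> * fps_X"
  proof -
    have "w has_fps_expansion fps_const \<i> * fps_X"
      unfolding w_def by (intro fps_expansion_intros)
    moreover have "w has_fps_expansion fps_expansion w 0"
      using holw by (intro has_fps_expansion_fps_expansion[of unit_disc]) auto
    ultimately show ?thesis
      using fps_expansion_unique_complex by blast
  qed
  \<comment> \<open>Here c1 = \<i> and c2 = 0, so a2 = \<i> and a3 = -3/4.\<close>
  then have "T22 f = - (25 / 16)"
    using starlike_B_coeffs[OF A nz holw w0 wd eq] by (simp add: T22_def power2_eq_square)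
  then have "cmod (T22 f) = 25 / 16"
    by simp
  ultimately show ?thesis by blast
qed

theorem theorem4p2:
  shows "(\<forall>f\<in>S_B. cmod (T22 f) \<le> 25 / 16) \<and> (\<exists>f\<in>S_B. cmod (T22 f) = 25 / 16)"
  using cmod_T22_le T22_extremal by blast

end
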